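(* Let $(G,\cdot,\wedge,\sqsubset,\vdash)$ be an algebraic system, where $(G,\cdot)$ is a semigroup, $(G,\wedge)$ is a semilattice, and $\sqsubset$, $\vdash$ are binary relations on $G$. Let $\leq$ be the semilattice order, $x\leq y\Leftrightarrow x\wedge y=x$. Then $(G,\cdot,\wedge,\sqsubset,\vdash)$ is isomorphic to some projection $\cap$-semigroup $(\Phi,\circ,\cap,\chi_\Phi,\delta_\Phi)$ of transformations if and only if all of the following conditions hold: 1. $\sqsubset$ is a left regular and right negative quasi-order on $(G,\cdot)$ that contains $\leq$ (i.e. $x\leq y$ implies $x\sqsubset y$); 2. $x(y\wedge z)=xy\wedge xz$ for all $x,y,z\in G$; 3. for all $x,y\in G$: if $x\sqsubset x\wedge y$, then $x\leq y$; 4. $(x\wedge y)u\leq yu$ for all $x,y\in G$, $u\in G^1$; 5. for all $x,y,z,v\in G$, $u\in G^1$: if $x\sqsubset y\wedge z$ and $x\sqsubset (z\wedge v)u$, then $x\sqsubset (y\wedge z\wedge v)u$; 6. for all $x,y\in G$: $x\vdash y$ if and only if $x\sqsubset xy$.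
   Context: A transformation of a non-empty set $A$ is a partial map $A\to A$, regarded as a subset of $A\times A$; $\mathcal F(A)$ is the set of all of them. For $f\in\mathcal F(A)$, $\mathrm{pr}_1 f$ is the domain and $\mathrm{pr}_2 f$ the image of $f$. Composition is $(g\circ f)(a)=g(f(a))$, both sides being defined or undefined simultaneously. If $\Phi\subset\mathcal F(A)$ is closed under $\circ$ and under set-theoretic intersection $\cap$, then $(\Phi,\circ,\cap)$ is a $\cap$-semigroup of transformations. On $\Phi$ put $\chi_\Phi=\{(f,g)\mid \mathrm{pr}_1 f\subset\mathrm{pr}_1 g\}$ and $\delta_\Phi=\{(f,g)\mid \mathrm{pr}_2 f\subset\mathrm{pr}_1 g\}$; $(\Phi,\circ,\cap,\chi_\Phi)$ is called a projection $\cap$-semigroup of transformations. Here $\subset$ denotes (not necessarily strict) inclusion. Isomorphism convention: $(G,\cdot,\wedge,\sqsubset,\vdash)$ is isomorphic to $(\Phi,\circ,\cap,\chi_\Phi,\delta_\Phi)$ (for some non-empty set $A$ and some $\Phi\subset\mathcal F(A)$ closed under $\circ$ and $\cap$) if there is a bijection $P:G\to\Phi$ such that for all $g_1,g_2\in G$: $P(g_1g_2)=P(g_2)\circ P(g_1)$, $P(g_1\wedge g_2)=P(g_1)\cap P(g_2)$, $g_1\sqsubset g_2\Leftrightarrow (P(g_1),P(g_2))\in\chi_\Phi$, and $g_1\vdash g_2\Leftrightarrow (P(g_1),P(g_2))\in\delta_\Phi$. A semilattice is a set with an associative, commutative, idempotent operation. A quasi-order is a reflexive and transitive relation. A relation $\rho$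 on a semigroup $G$ is left regular if $(u,v)\in\rho$ implies $(xu,xv)\in\rho$ for all $x,u,v\in G$, and right negative if $(x,yu)\in\rho$ implies $(x,y)\in\rho$ for all $x,y,u\in G$. $G^1$ denotes $G$ if $(G,\cdot)$ has an identity element, and otherwise $G\cup\{e\}$ with $e$ adjoined as an identity element for $\cdot$. *)

theory Defs
  imports Main
begin

(* Partial maps A \<rightharpoonup> A, as single-valued relations contained in A \<times> A;
   pr_1 and pr_2 are then Domain and Range. *)
definition transformations :: "'a set \<Rightarrow> 'a rel set" where
  "transformations A = {f. f \<subseteq> A \<times> A \<and> single_valued f}"

(* tcomp g f is "g after f", whereas relcomp (O) lists the relation applied first on the left. *)
definition tcomp :: "'a rel \<Rightarrow> 'a rel \<Rightarrow> 'a rel" where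
  "tcomp g f = f O g"

definition cap_semigroup :: "'a set \<Rightarrow> 'a rel set \<Rightarrow> bool" where
  "cap_semigroup A \<Phi> \<longleftrightarrow>
     A \<noteq> {} \<and> \<Phi> \<subseteq> transformations A \<and>
     (\<forall>f\<in>\<Phi>. \<forall>g\<in>\<Phi>. tcomp g f \<in> \<Phi>) \<and>
     (\<forall>f\<in>\<Phi>. \<forall>g\<in>\<Phi>. f \<inter> g \<in> \<Phi>)"

definition chi :: "'a rel set \<Rightarrow> 'a rel rel" where
  "chi \<Phi> = {(f, g). f \<in> \<Phi> \<and> g \<in> \<Phi> \<and> Domain f \<subseteq> Domain g}"

definition delta :: "'a rel set \<Rightarrow> 'a rel rel" where
  "delta \<Phi> = {(f, g). f \<in> \<Phi> \<and> g \<in> \<Phi> \<and> Range f \<subseteq> Domain g}"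

(* The product g1 g2 is sent to "P g2 after P g1". *)
definition isomorphic_to ::
  "('g \<Rightarrow> 'g \<Rightarrow> 'g) \<Rightarrow> ('g \<Rightarrow> 'g \<Rightarrow> 'g) \<Rightarrow> ('g \<Rightarrow> 'g \<Rightarrow> bool) \<Rightarrow> ('g \<Rightarrow> 'g \<Rightarrow> bool)
    \<Rightarrow> 'a rel set \<Rightarrow> bool" where
  "isomorphic_to mult meet sq vd \<Phi> \<longleftrightarrow>
     (\<exists>P. bij_betw P UNIV \<Phi> \<and>
        (\<forall>g1 g2. P (mult g1 g2) = tcomp (P g2) (P g1)) \<and>
        (\<forall>g1 g2. P (meet g1 g2) = P g1 \<inter> P g2) \<and>
        (\<forall>g1 g2. sq g1 g2 \<longleftrightarrow> (P g1, P g2) \<in> chi \<Phi>) \<and>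
        (\<forall>g1 g2. vd g1 g2 \<longleftrightarrow> (P g1, P g2) \<in> delta \<Phi>))"

(* The type argument is the type from which the underlying set A is taken,
   since HOL cannot quantify existentially over types.  For an algebra on 'g, the type
   'g \<times> 'g option set is large enough: a point can be taken as a pair of some a in G and a
   class of elements of G \<union> {e}, where x and y are equivalent with respect to a iff
   sq a (meet x y), and e is equivalent only to itself. *)
definition representable ::
  "'a itself \<Rightarrow> ('g \<Rightarrow> 'g \<Rightarrow> 'g) \<Rightarrow> ('g \<Rightarrow> 'g \<Rightarrow> 'g) \<Rightarrow> ('g \<Rightarrow> 'g \<Rightarrow> bool)
    \<Rightarrow> ('g \<Rightarrow> 'g \<Rightarrow> bool) \<Rightarrow> bool" where
  "representable (_ :: 'a itself) mult meet sq vd \<longleftrightarrow>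
     (\<exists>(A :: 'a set) \<Phi>. cap_semigroup A \<Phi> \<and> isomorphic_to mult meet sq vd \<Phi>)"

definition quasi_order :: "('g \<Rightarrow> 'g \<Rightarrow> bool) \<Rightarrow> bool" where
  "quasi_order R \<longleftrightarrow> reflp R \<and> transp R"

definition left_regular :: "('g \<Rightarrow> 'g \<Rightarrow> 'g) \<Rightarrow> ('g \<Rightarrow> 'g \<Rightarrow> bool) \<Rightarrow> bool" where
  "left_regular mult R \<longleftrightarrow> (\<forall>x u v. R u v \<longrightarrow> R (mult x u) (mult x v))"

definition right_negative :: "('g \<Rightarrow> 'g \<Rightarrow> 'g) \<Rightarrow> ('g \<Rightarrow> 'g \<Rightarrow> bool) \<Rightarrow> bool" where
  "right_negative mult R \<longleftrightarrow> (\<forall>x y u. R x (mult y u) \<longrightarrow> R x y)"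

(* G^1 inside 'g option: Some embeds G, and None is the adjoined identity,
   present only if G has no identity of its own. *)
definition adjoin_one :: "('g \<Rightarrow> 'g \<Rightarrow> 'g) \<Rightarrow> 'g option set" where
  "adjoin_one mult =
     (if \<exists>e. \<forall>x. mult e x = x \<and> mult x e = x then range Some else UNIV)"

(* The product in G^1 of an element of G with an element of G^1; it lies in G. *)
definition mult_one :: "('g \<Rightarrow> 'g \<Rightarrow> 'g) \<Rightarrow> 'g \<Rightarrow> 'g option \<Rightarrow> 'g" where
  "mult_one mult x u = (case u of None \<Rightarrow> x | Some v \<Rightarrow> mult x v)"

end

(* Necessity is a computation with partial maps. For sufficiency, each a in G gives the partial
   equivalence x ~ y iff sq a (meet x y) on {x. sq a x}; condition 5 makes it transitive and
   compatible with right multiplication. So G acts on its classes by right multiplication, partially,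
   and an additional base point, the class of the adjoined identity, is sent by g to the class
   of g. The representation is the disjoint union of these actions over all a; the base point of
   the copy a = g already separates g from the elements not above it. *)

theory Submission
  imports Defs
begin

section \<open>Transformations\<close>

lemma tcomp_Int_distrib:
  "single_valued f \<Longrightarrow> tcomp (g \<inter> h) f = tcomp g f \<inter> tcomp h f"
  unfolding tcomp_def single_valued_def by blast

lemma Domain_tcomp_mono: "Domain f \<subseteq> Domain g \<Longrightarrow> Domain (tcomp f h) \<subseteq> Domain (tcomp g h)"
  unfolding tcomp_def by blast

lemma Domain_tcomp_subset: "Domain (tcomp g f) \<subseteq> Domain f"
  unfolding tcomp_def by blast

lemma subset_if_Domain_subset_Int:
  "\<lbrakk>single_valued f; Domain f \<subseteq> Domain (f \<inter> g)\<rbrakk> \<Longrightarrow> f \<subseteq> g"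
  by (fastforce dest: single_valuedD)

text \<open>At a point of \<open>Domain f\<close>, \<open>h\<close> and \<open>g\<close> share a
  value and so do \<open>g\<close> and \<open>k\<close>; \<open>g\<close> is single-valued, so the
  two values coincide and all three share the one at which \<open>u\<close> is defined.\<close>

lemma Domain_tcomp_agree:
  assumes "single_valued g" "Domain f \<subseteq> Domain (h \<inter> g)" "Domain f \<subseteq> Domain (tcomp u (g \<inter> k))"
  shows "Domain f \<subseteq> Domain (tcomp u (h \<inter> g \<inter> k))"
proof
  fix a assume a: "a \<in> Domain f"
  then obtain b where b: "(a, b) \<in> h" "(a, b) \<in> g" using assms(2) by blast
  obtain c d where c: "(a, c) \<in> g" "(a, c) \<in> k" "(c, d) \<in> u"
    using a assms(3) unfolding tcomp_def by blast
  have "b = c" using assms(1) b(2) c(1) unfolding single_valued_def by blast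
  then show "a \<in> Domain (tcomp u (h \<inter> g \<inter> k))" using b c unfolding tcomp_def by blast
qed

text \<open>The composite can only pass through the one value of \<open>f\<close> at a point, so its
  being defined on all of \<open>Domain f\<close> tests every value of \<open>f\<close>. This
  reduces \<open>delta\<close> to \<open>chi\<close>.\<close>

lemma Range_subset_Domain_iff:
  "single_valued f \<Longrightarrow> Range f \<subseteq> Domain g \<longleftrightarrow> Domain f \<subseteq> Domain (tcomp g f)"
  unfolding tcomp_def single_valued_def by blast

section \<open>Abstract projection semigroups\<close>

text \<open>Quantification over G^1 is split: \<open>sq_meet\<close> is the identity case of
  \<open>sq_meet_mult\<close>, and the identity case of \<open>meet_mult_le\<close> is a semilattice
  law. The laws of the two operations are kept apart, being given on both sides of the
  equivalence.\<close>

locale projection_semigroup =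
  fixes mult :: "'g \<Rightarrow> 'g \<Rightarrow> 'g" (infixl "\<cdot>" 75)
    and meet :: "'g \<Rightarrow> 'g \<Rightarrow> 'g" (infixl "\<sqinter>" 70)
    and sq :: "'g \<Rightarrow> 'g \<Rightarrow> bool" (infix "\<sqsubset>" 50)
    and vd :: "'g \<Rightarrow> 'g \<Rightarrow> bool" (infix "\<turnstile>" 50)
  assumes sq_refl: "x \<sqsubset> x"
    and sq_trans: "\<lbrakk>x \<sqsubset> y; y \<sqsubset> z\<rbrakk> \<Longrightarrow> x \<sqsubset> z"
    and sq_left: "y \<sqsubset> z \<Longrightarrow> x \<cdot> y \<sqsubset> x \<cdot> z"
    and sq_right: "x \<sqsubset> y \<cdot> u \<Longrightarrow> x \<sqsubset> y"
    and sq_if_le: "x \<sqinter> y = x \<Longrightarrow> x \<sqsubset> y"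
    and distrib: "x \<cdot> (y \<sqinter> z) = x \<cdot> y \<sqinter> x \<cdot> z"
    and le_if_sq_meet: "x \<sqsubset> x \<sqinter> y \<Longrightarrow> x \<sqinter> y = x"
    and meet_mult_le: "(x \<sqinter> y) \<cdot> u \<sqinter> y \<cdot> u = (x \<sqinter> y) \<cdot> u"
    and sq_meet: "\<lbrakk>x \<sqsubset> y \<sqinter> z; x \<sqsubset> z \<sqinter> v\<rbrakk> \<Longrightarrow> x \<sqsubset> y \<sqinter> z \<sqinter> v"
    and sq_meet_mult: "\<lbrakk>x \<sqsubset> y \<sqinter> z; x \<sqsubset> (z \<sqinter> v) \<cdot> u\<rbrakk> \<Longrightarrow> x \<sqsubset> (y \<sqinter> z \<sqinter> v) \<cdot> u"
    and vd_iff: "x \<turnstile> y \<longleftrightarrow> x \<sqsubset> x \<cdot> y"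

lemma isomorphic_to_imp_projection_semigroup:
  assumes "cap_semigroup A \<Phi>" and "isomorphic_to mult meet sq vd \<Phi>"
  shows "projection_semigroup mult meet sq vd"
proof -
  obtain P where P: "bij_betw P UNIV \<Phi>"
    and mult: "\<And>x y. P (mult x y) = tcomp (P y) (P x)"
    and meet: "\<And>x y. P (meet x y) = P x \<inter> P y"
    and sq: "\<And>x y. sq x y \<longleftrightarrow> (P x, P y) \<in> chi \<Phi>"
    and vd: "\<And>x y. vd x y \<longleftrightarrow> (P x, P y) \<in> delta \<Phi>"
    using assms(2) unfolding isomorphic_to_def by blast
  have mem: "P x \<in> \<Phi>" for x using P by (auto simp: bij_betw_def)
  have sv: "single_valued (P x)" for x
    using mem[of x] assms(1) unfolding cap_semigroup_def transformations_def by blast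
  have eq: "x = y \<longleftrightarrow> P x = P y" for x y
    using P by (auto simp: bij_betw_def dest: injD)
  have sq: "sq x y \<longleftrightarrow> Domain (P x) \<subseteq> Domain (P y)" for x y
    unfolding sq chi_def using mem by simp
  have vd: "vd x y \<longleftrightarrow> Range (P x) \<subseteq> Domain (P y)" for x y
    unfolding vd delta_def using mem by simp
  show ?thesis
  proof
    fix x y z u v
    show "sq x x" unfolding sq by (rule subset_refl)
    show "sq x z" if "sq x y" "sq y z" using that unfolding sq by blast
    show "sq (mult x y) (mult x z)" if "sq y z"
      using that unfolding sq mult by (rule Domain_tcomp_mono)
    show "sq x y" if "sq x (mult y u)"
      using that unfolding sq mult by (rule order_trans[OF _ Domain_tcomp_subset])
    show "sq x y" if "meet x y = x" using that unfolding eq sq meet by blast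
    show "mult x (meet y z) = meet (mult x y) (mult x z)"
      unfolding eq mult meet by (rule tcomp_Int_distrib[OF sv])
    show "meet x y = x" if "sq x (meet x y)"
      using subset_if_Domain_subset_Int[OF sv, of x "P y"] that unfolding eq sq meet by blast
    show "meet (mult (meet x y) u) (mult y u) = mult (meet x y) u"
      unfolding eq mult meet tcomp_def by blast
    \<comment> \<open>The case without a right factor is composition with \<open>Id\<close>, which
      need not belong to \<open>\<Phi>\<close>: \<open>u\<close> may be any relation in
      \<open>Domain_tcomp_agree\<close>.\<close>
    show "sq x (meet (meet y z) v)" if "sq x (meet y z)" "sq x (meet z v)"
      using Domain_tcomp_agree[where u = Id, OF sv] that unfolding sq meet tcomp_def
      unfolding R_O_Id .
    show "sq x (mult (meet (meet y z) v) u)" if "sq x (meet y z)" "sq x (mult (meet z v) u)"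
      using that unfolding sq meet mult by (rule Domain_tcomp_agree[OF sv])
    show "vd x y \<longleftrightarrow> sq x (mult x y)"
      unfolding vd sq mult by (rule Range_subset_Domain_iff[OF sv])
  qed
qed

lemma representable_imp_projection_semigroup:
  "representable TYPE('a) mult meet sq vd \<Longrightarrow> projection_semigroup mult meet sq vd"
  unfolding representable_def using isomorphic_to_imp_projection_semigroup by blast

section \<open>The representation\<close>

locale projection_cap_semigroup =
  projection_semigroup + mult: semigroup mult + meet: semilattice meet
begin

text \<open>Read \<open>a \<sqsubset> x \<sqinter> y\<close> as: \<open>x\<close> and
  \<open>y\<close> are both defined at \<open>a\<close> and agree there. The triple meet supplied by
  \<open>sq_meet\<close> lies below \<open>x \<sqinter> z\<close>.\<close>

lemma agree_trans: "\<lbrakk>a \<sqsubset> x \<sqinter> y; a \<sqsubset> y \<sqinter> z\<rbrakk> \<Longrightarrow> a \<sqsubset> x \<sqinter> z"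
proof -
  assume "a \<sqsubset> x \<sqinter> y" "a \<sqsubset> y \<sqinter> z"
  then have "a \<sqsubset> x \<sqinter> y \<sqinter> z" by (rule sq_meet)
  moreover have "x \<sqinter> y \<sqinter> z \<sqinter> (x \<sqinter> z) = x \<sqinter> y \<sqinter> z"
    by (metis meet.assoc meet.commute meet.left_idem)
  ultimately show ?thesis by (blast intro: sq_trans sq_if_le)
qed

text \<open>Agreement at \<open>a\<close> is symmetric and transitive, hence reflexive on its field:
  going from \<open>x\<close> to \<open>y\<close> and back gives
  \<open>a \<sqsubset> x \<sqinter> x\<close>.\<close>

lemma sq_meetD:
  assumes "a \<sqsubset> x \<sqinter> y" shows "a \<sqsubset> x" "a \<sqsubset> y"
  by (metis assms agree_trans meet.commute meet.idem)+

text \<open>This makes right multiplication a partial operation on agreement classes: definedness at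
  one representative carries over to any other.\<close>

lemma agree_mult:
  assumes "a \<sqsubset> x \<sqinter> y" "a \<sqsubset> x \<cdot> u"
  shows "a \<sqsubset> x \<cdot> u \<sqinter> y \<cdot> u"
proof -
  \<comment> \<open>In \<open>sq_meet_mult\<close> both \<open>z\<close> and \<open>v\<close> are
    taken to be \<open>x\<close>, so that its second premise collapses to
    \<open>a \<sqsubset> x \<cdot> u\<close>.\<close>
  have "a \<sqsubset> (y \<sqinter> x \<sqinter> x) \<cdot> u"
    using assms by (intro sq_meet_mult) (simp_all add: meet.commute)
  then have "a \<sqsubset> (x \<sqinter> y) \<cdot> u"
    by (metis meet.commute meet.left_idem)
  moreover have "(x \<sqinter> y) \<cdot> u \<sqinter> (x \<cdot> u \<sqinter> y \<cdot> u) = (x \<sqinter> y) \<cdot> u"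
    by (metis meet_mult_le meet.assoc meet.commute)
  ultimately show ?thesis by (blast intro: sq_trans sq_if_le)
qed

text \<open>Here \<open>None\<close> is a new formal identity even if the semigroup has one of its
  own, so that every copy gets a separate base point.\<close>

fun one_mult :: "'a option \<Rightarrow> 'a \<Rightarrow> 'a" where
  "one_mult None g = g"
| "one_mult (Some x) g = x \<cdot> g"

text \<open>An element undefined at \<open>a\<close> has the empty class, since agreement with
  anything would force definedness. The base point \<open>{None}\<close> differs from every class of
  elements.\<close>

fun agree_class :: "'a \<Rightarrow> 'a option \<Rightarrow> 'a option set" where
  "agree_class a None = {None}"
| "agree_class a (Some x) = Some ` {y. a \<sqsubset> x \<sqinter> y}"

declare agree_class.simps(2) [simp del]

text \<open>Tagging points with \<open>a\<close> makes the union of the copies disjoint. The set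
  runs over representatives \<open>x\<close>; that the image does not depend on them is settled by
  \<open>agree_class_one_mult\<close>.\<close>

definition repr :: "'a \<Rightarrow> ('a \<times> 'a option set) rel" where
  "repr g = {((a, agree_class a x), (a, agree_class a (Some (one_mult x g)))) | a x.
     a \<sqsubset> one_mult x g}"

text \<open>The hypothesis places \<open>x\<close> in its own class, so equal classes give
  agreement; elements undefined at \<open>a\<close> share the empty class without agreeing.\<close>

lemma agree_class_Some_eq_iff:
  assumes "a \<sqsubset> x"
  shows "agree_class a (Some x) = agree_class a (Some y) \<longleftrightarrow> a \<sqsubset> x \<sqinter> y"
proof
  assume "agree_class a (Some x) = agree_class a (Some y)"
  then have "{z. a \<sqsubset> x \<sqinter> z} = {z. a \<sqsubset> y \<sqinter> z}" by (simp add: agree_class.simps inj_image_eq_iff)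
  then show "a \<sqsubset> x \<sqinter> y" using assms by (metis meet.commute meet.idem mem_Collect_eq)
next
  assume "a \<sqsubset> x \<sqinter> y"
  then have "a \<sqsubset> x \<sqinter> z \<longleftrightarrow> a \<sqsubset> y \<sqinter> z" for z by (metis agree_trans meet.commute)
  then show "agree_class a (Some x) = agree_class a (Some y)"
    by (simp add: agree_class.simps)
qed

text \<open>Well-definedness of the partial action: for classes of elements this is
  \<open>agree_mult\<close>, and the base point has \<open>None\<close> as its only
  representative.\<close>

lemma agree_class_one_mult:
  assumes "agree_class a x = agree_class a y" "a \<sqsubset> one_mult x g"
  shows "a \<sqsubset> one_mult y g \<and>
    agree_class a (Some (one_mult x g)) = agree_class a (Some (one_mult y g))"
proof (cases x)
  case None
  then have "y = None" using assms(1) by (cases y) (auto simp: agree_class.simps)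
  then show ?thesis using None assms(2) by simp
next
  case (Some u)
  \<comment> \<open>Right negativity makes \<open>u\<close> itself defined at \<open>a\<close>,
    which is required to read equality of classes as agreement.\<close>
  then have u: "a \<sqsubset> u \<cdot> g" "a \<sqsubset> u" using assms(2) sq_right by auto
  show ?thesis
  proof (cases y)
    case None
    then show ?thesis using assms(1) Some by (auto simp: agree_class.simps)
  next
    case v: (Some v)
    then have "a \<sqsubset> u \<sqinter> v" using assms(1) Some agree_class_Some_eq_iff[OF u(2)] by metis
    then have uv: "a \<sqsubset> u \<cdot> g \<sqinter> v \<cdot> g" using u(1) by (rule agree_mult)
    then show ?thesis
      using Some v agree_class_Some_eq_iff[OF u(1)] sq_meetD(2)[OF uv] by (metis one_mult.simps(2))
  qed
qed

lemma mem_reprE: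
  assumes "(p, q) \<in> repr g"
  obtains a x where "p = (a, agree_class a x)" "a \<sqsubset> one_mult x g"
    "q = (a, agree_class a (Some (one_mult x g)))"
  using assms unfolding repr_def by blast

text \<open>By well-definedness of the action, any representative of a point may be used to compute
  its image.\<close>

lemma mem_repr_iff:
  "((a, agree_class a x), q) \<in> repr g \<longleftrightarrow>
     a \<sqsubset> one_mult x g \<and> q = (a, agree_class a (Some (one_mult x g)))"
proof
  assume "((a, agree_class a x), q) \<in> repr g"
  then obtain b y where y: "(a, agree_class a x) = (b, agree_class b y)" "b \<sqsubset> one_mult y g"
    "q = (b, agree_class b (Some (one_mult y g)))"
    by (rule mem_reprE)
  then have "b = a" "agree_class a y = agree_class a x" by (metis prod.inject)+
  then show "a \<sqsubset> one_mult x g \<and> q = (a, agree_class a (Some (one_mult x g)))"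
    using agree_class_one_mult[of a y x g] y(2,3) by simp
next
  assume "a \<sqsubset> one_mult x g \<and> q = (a, agree_class a (Some (one_mult x g)))"
  then show "((a, agree_class a x), q) \<in> repr g" unfolding repr_def by blast
qed

lemma Domain_repr_iff:
  "(a, agree_class a x) \<in> Domain (repr g) \<longleftrightarrow> a \<sqsubset> one_mult x g"
  by (auto simp: Domain_iff mem_repr_iff)

lemma single_valued_repr: "single_valued (repr g)"
proof (rule single_valuedI)
  fix p q r assume "(p, q) \<in> repr g" "(p, r) \<in> repr g"
  moreover from this(1) obtain a x where "p = (a, agree_class a x)" by (elim mem_reprE)
  ultimately show "q = r" by (simp add: mem_repr_iff)
qed

section \<open>Compatibility with product, meet and domain inclusion\<close>

lemma one_mult_assoc: "one_mult x (g \<cdot> h) = one_mult x g \<cdot> h"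
  by (cases x) (simp_all add: mult.assoc)

lemma one_mult_meet: "one_mult x (g \<sqinter> h) = one_mult x g \<sqinter> one_mult x h"
  by (cases x) (simp_all add: distrib)

lemma sq_one_mult: "g \<sqsubset> h \<Longrightarrow> one_mult x g \<sqsubset> one_mult x h"
  by (cases x) (simp_all add: sq_left)

lemma repr_mult: "repr (g \<cdot> h) = tcomp (repr h) (repr g)"
proof (intro equalityI subrelI)
  fix p q assume "(p, q) \<in> repr (g \<cdot> h)"
  then obtain a x where p: "p = (a, agree_class a x)" "a \<sqsubset> one_mult x g \<cdot> h"
    "q = (a, agree_class a (Some (one_mult x g \<cdot> h)))"
    by (auto simp: one_mult_assoc elim: mem_reprE)
  \<comment> \<open>Right negativity: if the full product is defined at \<open>a\<close>, so is its
    prefix, which gives the intermediate point.\<close>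
  then have "(p, a, agree_class a (Some (one_mult x g))) \<in> repr g"
    using sq_right mem_repr_iff by blast
  moreover have "((a, agree_class a (Some (one_mult x g))), q) \<in> repr h"
    using p mem_repr_iff by simp
  ultimately show "(p, q) \<in> tcomp (repr h) (repr g)" unfolding tcomp_def by blast
next
  fix p q assume "(p, q) \<in> tcomp (repr h) (repr g)"
  then obtain r where r: "(p, r) \<in> repr g" "(r, q) \<in> repr h" unfolding tcomp_def by blast
  from r(1) obtain a x where p: "p = (a, agree_class a x)"
    "r = (a, agree_class a (Some (one_mult x g)))" by (blast elim: mem_reprE)
  have "a \<sqsubset> one_mult x g \<cdot> h \<and> q = (a, agree_class a (Some (one_mult x g \<cdot> h)))"
    using r(2) unfolding p(2) mem_repr_iff by simp
  then show "(p, q) \<in> repr (g \<cdot> h)" unfolding p(1) mem_repr_iff one_mult_assoc .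
qed

text \<open>Where the two products agree at \<open>a\<close>, they and their meet have one common
  class. Where they do not, their classes differ if both are defined, so neither side has a
  pair.\<close>

lemma repr_meet: "repr (g \<sqinter> h) = repr g \<inter> repr h"
proof -
  have "((a, agree_class a x), q) \<in> repr (g \<sqinter> h) \<longleftrightarrow>
    ((a, agree_class a x), q) \<in> repr g \<inter> repr h" for a x q
  proof -
    let ?u = "one_mult x g" and ?v = "one_mult x h"
    have meet_class: "agree_class a (Some (?u \<sqinter> ?v)) = agree_class a (Some ?u)"
      "agree_class a (Some ?u) = agree_class a (Some ?v)" if "a \<sqsubset> ?u \<sqinter> ?v"
      using that sq_meetD[OF that]
      by (simp_all add: agree_class_Some_eq_iff meet.commute meet.left_commute)
    show ?thesis
    proof (cases "a \<sqsubset> ?u \<sqinter> ?v")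
      case True
      then show ?thesis
        using sq_meetD[OF True] by (simp add: mem_repr_iff one_mult_meet meet_class)
    next
      case False
      then show ?thesis by (auto simp: mem_repr_iff one_mult_meet agree_class_Some_eq_iff)
    qed
  qed
  moreover have "repr k \<subseteq> {((a, agree_class a x), q) | a x q. True}" for k
    unfolding repr_def by blast
  ultimately show ?thesis by blast
qed

lemma sq_iff_Domain_repr: "g \<sqsubset> h \<longleftrightarrow> Domain (repr g) \<subseteq> Domain (repr h)"
proof
  assume "g \<sqsubset> h"
  then have "a \<sqsubset> one_mult x g \<Longrightarrow> a \<sqsubset> one_mult x h" for a x
    by (blast intro: sq_trans sq_one_mult)
  then show "Domain (repr g) \<subseteq> Domain (repr h)"
    by (fastforce elim!: mem_reprE simp: Domain_repr_iff)
next
  assume "Domain (repr g) \<subseteq> Domain (repr h)"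
  \<comment> \<open>The base point of the copy indexed by \<open>g\<close> is the test point: it
    lies in \<open>Domain (repr h)\<close> exactly when \<open>g \<sqsubset> h\<close>.\<close>
  moreover have "(g, agree_class g None) \<in> Domain (repr g)"
    unfolding Domain_repr_iff by (simp add: sq_refl)
  ultimately have "(g, agree_class g None) \<in> Domain (repr h)" by (rule subsetD)
  then show "g \<sqsubset> h" unfolding Domain_repr_iff by simp
qed

text \<open>Equal representations coincide with that of the meet, so the domain criterion and
  \<open>le_if_sq_meet\<close> put each element below the other.\<close>

lemma inj_repr: "inj repr"
proof (rule injI)
  fix g h assume eq: "repr g = repr h"
  then have "repr (g \<sqinter> h) = repr g" "repr (g \<sqinter> h) = repr h" by (simp_all add: repr_meet)
  then have "g \<sqinter> h = g" "h \<sqinter> g = h"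
    using le_if_sq_meet sq_iff_Domain_repr meet.commute by (metis subset_refl)+
  then show "g = h" by (metis meet.commute)
qed

text \<open>The relation \<open>vd\<close> follows from the rest: \<open>vd_iff\<close> expresses it
  through \<open>sq\<close> and the product just as range inclusion is expressed through domain
  inclusion of a composite.\<close>

lemma representable_product: "representable TYPE('a \<times> 'a option set) mult meet sq vd"
proof -
  have "cap_semigroup UNIV (range repr)"
    using single_valued_repr
    by (auto simp: cap_semigroup_def transformations_def simp flip: repr_mult repr_meet)
  moreover have "isomorphic_to mult meet sq vd (range repr)"
    unfolding isomorphic_to_def chi_def delta_def
    using inj_repr by (intro exI[of _ repr])
      (simp add: bij_betw_def repr_mult repr_meet vd_iff sq_iff_Domain_repr
        Range_subset_Domain_iff[OF single_valued_repr])
  ultimately show ?thesis unfolding representable_def by blast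
qed

end

section \<open>Equivalence with the stated conditions, and the characterisation\<close>

text \<open>Condition 5 for the adjoined identity is not literally an instance when the semigroup has an
  identity of its own; it is then the instance for that identity.\<close>

lemma projection_semigroup_iff:
  fixes mult :: "'g \<Rightarrow> 'g \<Rightarrow> 'g" (infixl "\<cdot>" 75)
    and meet :: "'g \<Rightarrow> 'g \<Rightarrow> 'g" (infixl "\<sqinter>" 70)
    and sq :: "'g \<Rightarrow> 'g \<Rightarrow> bool" (infix "\<sqsubset>" 50)
    and vd :: "'g \<Rightarrow> 'g \<Rightarrow> bool" (infix "\<turnstile>" 50)
    and le :: "'g \<Rightarrow> 'g \<Rightarrow> bool" (infix "\<preceq>" 50)
  assumes "semilattice meet" and le: "\<And>x y. x \<preceq> y \<longleftrightarrow> x \<sqinter> y = x"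
  shows "projection_semigroup mult meet sq vd \<longleftrightarrow>
        (quasi_order sq \<and> left_regular mult sq \<and> right_negative mult sq \<and>
          (\<forall>x y. x \<preceq> y \<longrightarrow> x \<sqsubset> y)) \<and>
        (\<forall>x y z. x \<cdot> (y \<sqinter> z) = x \<cdot> y \<sqinter> x \<cdot> z) \<and>
        (\<forall>x y. x \<sqsubset> x \<sqinter> y \<longrightarrow> x \<preceq> y) \<and>
        (\<forall>x y. \<forall>u\<in>adjoin_one mult. mult_one mult (x \<sqinter> y) u \<preceq> mult_one mult y u) \<and>
        (\<forall>x y z v. \<forall>u\<in>adjoin_one mult.
          x \<sqsubset> y \<sqinter> z \<and> x \<sqsubset> mult_one mult (z \<sqinter> v) u \<longrightarrow>
          x \<sqsubset> mult_one mult (y \<sqinter> z \<sqinter> v) u) \<and>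
        (\<forall>x y. x \<turnstile> y \<longleftrightarrow> x \<sqsubset> x \<cdot> y)"
    (is "_ \<longleftrightarrow> ?order \<and> ?distrib \<and> ?le \<and> ?mono \<and> ?agree \<and> ?vd")
proof
  assume "projection_semigroup mult meet sq vd"
  then interpret projection_semigroup mult meet sq vd .
  interpret semilattice meet by fact
  have ?order unfolding quasi_order_def left_regular_def right_negative_def le
    using sq_refl sq_left sq_right sq_if_le by (blast intro: reflpI transpI sq_trans)
  \<comment> \<open>The \<open>None\<close> case is
    \<open>x \<sqinter> y \<sqinter> y = x \<sqinter> y\<close>, by associativity and
    idempotence.\<close>
  moreover have ?mono
    by (auto simp: le mult_one_def meet_mult_le assoc split: option.split)
  moreover have ?agree
    using sq_meet sq_meet_mult by (auto simp: mult_one_def split: option.split)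
  ultimately show "?order \<and> ?distrib \<and> ?le \<and> ?mono \<and> ?agree \<and> ?vd"
    using distrib le_if_sq_meet vd_iff unfolding le by blast
next
  assume conds: "?order \<and> ?distrib \<and> ?le \<and> ?mono \<and> ?agree \<and> ?vd"
  then have order: "quasi_order sq" "left_regular mult sq" "right_negative mult sq"
    and ?mono and agree: ?agree by blast+
  have Some: "Some u \<in> adjoin_one mult" for u by (simp add: adjoin_one_def)
  obtain e where e: "e \<in> adjoin_one mult" "\<And>x. mult_one mult x e = x"
  proof (cases "\<exists>e. \<forall>x. e \<cdot> x = x \<and> x \<cdot> e = x")
    case True
    then obtain e where "\<And>x. x \<cdot> e = x" by blast
    then show ?thesis using that[of "Some e"] Some by (simp add: mult_one_def)
  next
    case False
    then have "None \<in> adjoin_one mult" unfolding adjoin_one_def by simp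
    then show ?thesis using that[of None] by (simp add: mult_one_def)
  qed
  show "projection_semigroup mult meet sq vd"
  proof
    fix x y z u v
    show "x \<sqsubset> x" using order(1) unfolding quasi_order_def by (blast dest: reflpD)
    show "x \<sqsubset> z" if "x \<sqsubset> y" "y \<sqsubset> z"
      using order(1) that unfolding quasi_order_def by (blast dest: transpD)
    show "x \<cdot> y \<sqsubset> x \<cdot> z" if "y \<sqsubset> z" using order(2) that unfolding left_regular_def by blast
    show "x \<sqsubset> y" if "x \<sqsubset> y \<cdot> u" using order(3) that unfolding right_negative_def by blast
    show "(x \<sqinter> y) \<cdot> u \<sqinter> y \<cdot> u = (x \<sqinter> y) \<cdot> u"
      using \<open>?mono\<close> Some[of u] unfolding le by (fastforce simp: mult_one_def)
    show "x \<sqsubset> y \<sqinter> z \<sqinter> v" if "x \<sqsubset> y \<sqinter> z" "x \<sqsubset> z \<sqinter> v"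
      using agree e that by metis
    show "x \<sqsubset> (y \<sqinter> z \<sqinter> v) \<cdot> u" if "x \<sqsubset> y \<sqinter> z" "x \<sqsubset> (z \<sqinter> v) \<cdot> u"
    proof -
      have "x \<sqsubset> mult_one mult (z \<sqinter> v) (Some u)" using that(2) by (simp add: mult_one_def)
      then have "x \<sqsubset> mult_one mult (y \<sqinter> z \<sqinter> v) (Some u)" using agree Some that(1) by blast
      then show ?thesis by (simp add: mult_one_def)
    qed
  qed (use conds le in blast)+
qed

text \<open>The abstract conditions do not mention the carrier type: a representation over any type
  \<open>'a\<close> yields them, and they yield one over the product type. The second conjunct
  records that fixing this type loses no generality.\<close>

theorem theorem5:
  fixes mult :: "'g \<Rightarrow> 'g \<Rightarrow> 'g" (infixl "\<cdot>" 75)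
    and meet :: "'g \<Rightarrow> 'g \<Rightarrow> 'g" (infixl "\<sqinter>" 70)
    and sq :: "'g \<Rightarrow> 'g \<Rightarrow> bool" (infix "\<sqsubset>" 50)
    and vd :: "'g \<Rightarrow> 'g \<Rightarrow> bool" (infix "\<turnstile>" 50)
    and le :: "'g \<Rightarrow> 'g \<Rightarrow> bool" (infix "\<preceq>" 50)
  assumes "semigroup mult"
    and "semilattice meet"
    and "\<And>x y. x \<preceq> y \<longleftrightarrow> x \<sqinter> y = x"
  shows
    "(representable TYPE('g \<times> 'g option set) mult meet sq vd \<longleftrightarrow>
        (quasi_order sq \<and> left_regular mult sq \<and> right_negative mult sq \<and>
          (\<forall>x y. x \<preceq> y \<longrightarrow> x \<sqsubset> y)) \<and>
        (\<forall>x y z. x \<cdot> (y \<sqinter> z) = x \<cdot> y \<sqinter> x \<cdot> z) \<and>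
        (\<forall>x y. x \<sqsubset> x \<sqinter> y \<longrightarrow> x \<preceq> y) \<and>
        (\<forall>x y. \<forall>u\<in>adjoin_one mult. mult_one mult (x \<sqinter> y) u \<preceq> mult_one mult y u) \<and>
        (\<forall>x y z v. \<forall>u\<in>adjoin_one mult.
          x \<sqsubset> y \<sqinter> z \<and> x \<sqsubset> mult_one mult (z \<sqinter> v) u \<longrightarrow>
          x \<sqsubset> mult_one mult (y \<sqinter> z \<sqinter> v) u) \<and>
        (\<forall>x y. x \<turnstile> y \<longleftrightarrow> x \<sqsubset> x \<cdot> y))
     \<and> (representable TYPE('a) mult meet sq vd \<longrightarrow>
        representable TYPE('g \<times> 'g option set) mult meet sq vd)"
proof -
  have complete: "representable TYPE('g \<times> 'g option set) mult meet sq vd"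
    if "projection_semigroup mult meet sq vd"
  proof -
    interpret projection_cap_semigroup mult meet sq vd
      by (intro projection_cap_semigroup.intro that assms)
    show ?thesis by (rule representable_product)
  qed
  show ?thesis
    unfolding projection_semigroup_iff[OF assms(2,3), symmetric]
    by (intro conjI iffI impI complete) (assumption | erule representable_imp_projection_semigroup)+
qed

end
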